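(* For every integer $n\ge3$ there exist a hypergraph $\mathcal I_n$ on $N=O(2^n)$ vertices and two vertices $a,b$ of $\mathcal I_n$ such that (1) $\mathcal I_n$ admits a fractional $(\{a\},\{b\})$-separator $x$ with $\rho^*_{\mathcal I_n}(x)\le8$, and (2) every $(\{a\},\{b\})$-separator $S$ in $\mathcal I_n$ satisfies $\rho^*_{\mathcal I_n}(S)=\Omega(\log N)$.
   Context: A hypergraph $H$ has a finite vertex set and a set $E(H)$ of nonempty vertex subsets (hyperedges), every vertex in some hyperedge. Paths are in the primal graph (vertices adjacent iff they share a hyperedge). An $(A,B)$-separator is $S\subseteq V(H)$ such that no path avoiding $S$ joins $A\setminus S$ to $B\setminus S$. For $x:V(H)\to[0,1]$, $\mathrm{dist}^*_{H,x}(u,v)=\min\{1,\min_P\sum_{w\in V(P)}x(w)\}$ over $u$-$v$ paths $P$, and $x$ is a fractional $(A,B)$-separator if $\mathrm{dist}^*_{H,x}(u,v)\ge1$ for all $(u,v)\in A\times B$. $\rho^*_H(x)$ is the minimum of $\sum_e y(e)$ over $y:E(H)\to[0,1]$ with $\sum_{e\ni v}y(e)\ge x(v)$ for all $v$, and $\rho^*_H(S)=\rho^*_H(\mathbf 1_S)$.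
   Formalization: (2) is claimed only for separators S containing neither a nor b, since S={a} is always a separator with ρ*≤1, so the bound fails as N grows; in addition x(a)=x(b)=0 is required and N=O(2^n) is read as N of order exactly 2^n, both of which strengthen the claim. *)

theory Defs
  imports Complex_Main "HOL-Library.Indicator_Function"
begin

definition hypergraph :: "'a set \<Rightarrow> 'a set set \<Rightarrow> bool" where
  "hypergraph V E \<longleftrightarrow>
     finite V \<and> (\<forall>e\<in>E. e \<noteq> {} \<and> e \<subseteq> V) \<and> (\<forall>v\<in>V. \<exists>e\<in>E. v \<in> e)"

definition primal_adj :: "'a set set \<Rightarrow> 'a \<Rightarrow> 'a \<Rightarrow> bool" where
  "primal_adj E u v \<longleftrightarrow> u \<noteq> v \<and> (\<exists>e\<in>E. u \<in> e \<and> v \<in> e)"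

text \<open>A path is the list of its (pairwise distinct) vertices; a single vertex is a path
  from that vertex to itself.\<close>

definition primal_path :: "'a set \<Rightarrow> 'a set set \<Rightarrow> 'a \<Rightarrow> 'a \<Rightarrow> 'a list \<Rightarrow> bool" where
  "primal_path V E u v p \<longleftrightarrow>
     p \<noteq> [] \<and> hd p = u \<and> last p = v \<and> distinct p \<and> set p \<subseteq> V \<and>
     (\<forall>i. Suc i < length p \<longrightarrow> primal_adj E (p ! i) (p ! Suc i))"

definition separator :: "'a set \<Rightarrow> 'a set set \<Rightarrow> 'a set \<Rightarrow> 'a set \<Rightarrow> 'a set \<Rightarrow> bool" where
  "separator V E A B S \<longleftrightarrow>
     S \<subseteq> V \<and> (\<forall>u\<in>A - S. \<forall>v\<in>B - S. \<not> (\<exists>p. primal_path V E u v p \<and> set p \<inter> S = {}))"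

text \<open>For finite \<open>V\<close> there are only finitely many paths, so the minimum below is genuine.
  Inserting \<open>1\<close> truncates at \<open>1\<close> and also yields \<open>1\<close> if there is no path at all.\<close>

definition frac_dist :: "'a set \<Rightarrow> 'a set set \<Rightarrow> ('a \<Rightarrow> real) \<Rightarrow> 'a \<Rightarrow> 'a \<Rightarrow> real" where
  "frac_dist V E x u v = Min (insert 1 {(\<Sum>w\<in>set p. x w) | p. primal_path V E u v p})"

definition frac_separator ::
  "'a set \<Rightarrow> 'a set set \<Rightarrow> 'a set \<Rightarrow> 'a set \<Rightarrow> ('a \<Rightarrow> real) \<Rightarrow> bool" where
  "frac_separator V E A B x \<longleftrightarrow>
     (\<forall>v\<in>V. 0 \<le> x v \<and> x v \<le> 1) \<and> (\<forall>u\<in>A. \<forall>v\<in>B. frac_dist V E x u v \<ge> 1)"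

definition frac_edge_cover ::
  "'a set \<Rightarrow> 'a set set \<Rightarrow> ('a \<Rightarrow> real) \<Rightarrow> ('a set \<Rightarrow> real) \<Rightarrow> bool" where
  "frac_edge_cover V E x y \<longleftrightarrow>
     (\<forall>e\<in>E. 0 \<le> y e \<and> y e \<le> 1) \<and> (\<forall>v\<in>V. (\<Sum>e\<in>{e\<in>E. v \<in> e}. y e) \<ge> x v)"

text \<open>For a hypergraph and \<open>x\<close> with values in \<open>[0,1]\<close> the feasible set is compact and nonempty
  (\<open>y = 1\<close> is feasible), so the infimum is the minimum.\<close>

definition rho_star :: "'a set \<Rightarrow> 'a set set \<Rightarrow> ('a \<Rightarrow> real) \<Rightarrow> real" where
  "rho_star V E x = Inf {(\<Sum>e\<in>E. y e) | y. frac_edge_cover V E x y}"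

abbreviation rho_star_set :: "'a set \<Rightarrow> 'a set set \<Rightarrow> 'a set \<Rightarrow> real" where
  "rho_star_set V E S \<equiv> rho_star V E (indicator S)"

text \<open>An endpoint on its own is a separator in the above sense, and its cover number is at most
  \<open>1\<close>. Hence a lower bound on all \<open>({a},{b})\<close>-separators that tends to infinity has to be read as
  one on the separators that avoid both \<open>a\<close> and \<open>b\<close>. Likewise, the indicator of an endpoint is a
  fractional separator, so a gap is only meaningful for an \<open>x\<close> that vanishes on both endpoints.\<close>

lemma endpoint_separator:
  assumes "hypergraph V E" "a \<in> V"
  shows "separator V E {a} {b} {a}" "rho_star_set V E {a} \<le> 1"
proof -
  show "separator V E {a} {b} {a}"
    using assms by (simp add: separator_def)
  have "finite E"
    using assms by (auto simp: hypergraph_def intro!: finite_subset[of E "Pow V"])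
  obtain e0 where e0: "e0 \<in> E" "a \<in> e0"
    using assms by (auto simp: hypergraph_def)
  define y :: "'a set \<Rightarrow> real" where "y = (\<lambda>e. if e = e0 then 1 else 0)"
  have "frac_edge_cover V E (indicator {a}) y"
    using e0 \<open>finite E\<close> by (auto simp: frac_edge_cover_def y_def indicator_def)
  moreover have "(\<Sum>e\<in>E. y e) = 1"
    using e0 \<open>finite E\<close> by (simp add: y_def)
  ultimately have "1 \<in> {(\<Sum>e\<in>E. y e) | y. frac_edge_cover V E (indicator {a}) y}"
    by (smt (verit) mem_Collect_eq)
  moreover have "bdd_below {(\<Sum>e\<in>E. y e) | y. frac_edge_cover V E (indicator {a}) y}"
    by (rule bdd_belowI[of _ 0]) (auto simp: frac_edge_cover_def intro!: sum_nonneg)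
  ultimately show "rho_star_set V E {a} \<le> 1"
    unfolding rho_star_def by (rule cInf_lower)
qed

end

theory Submission
  imports Defs "HOL-Library.Discrete_Functions"
begin

text \<open>
  Cut \<open>[0,1]\<close> into \<open>2 ^ n\<close> leaf intervals and take two copies of every dyadic interval of level
  \<open>0, \<dots>, n - 1\<close>, adjacent whenever the intervals touch. With \<open>x\<close> the length of the interval, a
  path from the left end to the right end covers \<open>[0,1]\<close> and so has weight at least \<open>1\<close>, while a
  separator must contain both copies of all intervals above some leaf \<open>t\<close>. The two copies of an
  interval belong to its two halves. Each leaf \<open>t\<close> gets a hyperedge \<open>W t\<close> consisting, for every
  interval above \<open>t\<close>, of the copy for the half containing \<open>t\<close>. Weight \<open>2 / 2 ^ n\<close> on each \<open>W t\<close>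
  covers \<open>x\<close> at total cost \<open>2\<close>. On the other hand, let \<open>P\<close> consist of the opposite copies above \<open>t\<close>;
  a hyperedge \<open>W s\<close> meets \<open>P\<close> only in the interval where \<open>s\<close> and \<open>t\<close> part, so covering the \<open>n\<close>
  elements of \<open>P\<close> costs at least \<open>n / 2\<close> (the \<open>2\<close> is due to the two-element hyperedges).
\<close>

section \<open>Paths and fractional covers\<close>

text \<open>Vertices must stay distinct: if \<open>w\<close> already lies on \<open>p\<close>, the
  path is cut off there instead of extended.\<close>

lemma primal_path_snoc:
  assumes p: "primal_path V E u v p" and "primal_adj E v w" "w \<in> V"
  shows "\<exists>q. primal_path V E u w q \<and> set q \<subseteq> insert w (set p)"
proof (cases "w \<in> set p")
  case True
  then obtain xs ys where xs: "p = xs @ w # ys"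
    by (meson split_list)
  have "primal_adj E ((xs @ [w]) ! i) ((xs @ [w]) ! Suc i)" if "Suc i < length (xs @ [w])" for i
  proof -
    have "primal_adj E (p ! i) (p ! Suc i)"
      using p that xs by (auto simp: primal_path_def)
    then show ?thesis
      using that by (auto simp: xs nth_append less_Suc_eq split: if_splits)
  qed
  then have "primal_path V E u w (xs @ [w])"
    using p by (auto simp: primal_path_def xs hd_append)
  then show ?thesis
    by (intro exI[of _ "xs @ [w]"]) (auto simp: xs)
next
  case False
  have "primal_adj E ((p @ [w]) ! i) ((p @ [w]) ! Suc i)" if "Suc i < length (p @ [w])" for i
  proof (cases "Suc i < length p")
    case True
    then show ?thesis
      using p by (auto simp: primal_path_def nth_append)
  next
    case False
    then have i: "i = length p - 1" "p \<noteq> []" "Suc i = length p"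
      using that p by (auto simp: primal_path_def)
    then have "p ! i = v"
      using p last_conv_nth[of p] by (auto simp: primal_path_def)
    then show ?thesis
      using i assms by (simp add: nth_append)
  qed
  then have "primal_path V E u w (p @ [w])"
    using p False assms by (auto simp: primal_path_def)
  then show ?thesis
    by (intro exI[of _ "p @ [w]"]) auto
qed

text \<open>The walk may revisit vertices or stand still, as happens when one interval serves
  several leaves in a row.\<close>

lemma primal_path_of_walk:
  assumes "g 0 \<in> V - S" "\<And>i. i < m \<Longrightarrow> g (Suc i) \<in> V - S"
    and "\<And>i. i < m \<Longrightarrow> \<exists>e\<in>E. g i \<in> e \<and> g (Suc i) \<in> e"
  shows "\<exists>p. primal_path V E (g 0) (g m) p \<and> set p \<inter> S = {}"
  using assms(2,3)
proof (induction m)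
  case 0
  show ?case
    using assms(1) by (intro exI[of _ "[g 0]"]) (auto simp: primal_path_def)
next
  case (Suc m)
  then obtain p where p: "primal_path V E (g 0) (g m) p" "set p \<inter> S = {}"
    by (meson less_Suc_eq)
  show ?case
  proof (cases "g m = g (Suc m)")
    case True
    then show ?thesis
      using p by auto
  next
    case False
    then have "primal_adj E (g m) (g (Suc m))" "g (Suc m) \<in> V - S"
      using Suc.prems by (auto simp: primal_adj_def)
    then show ?thesis
      using primal_path_snoc[OF p(1)] p(2) by blast
  qed
qed

text \<open>Telescoping, with each rise of the potential \<open>f\<close> charged to the vertex
  entered; the start vertex is never entered, hence \<open>0 \<le> x u\<close>.\<close>

lemma primal_path_potential:
  fixes f x :: "'a \<Rightarrow> real"
  assumes p: "primal_path V E u v p"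
    and step: "\<And>w w'. primal_adj E w w' \<Longrightarrow> f w' - f w \<le> x w'"
    and "0 \<le> x u"
  shows "f v - f u \<le> (\<Sum>w\<in>set p. x w)"
proof -
  have "f (last q) - f (hd q) \<le> sum_list (map x (tl q))"
    if "q \<noteq> []" "\<forall>i. Suc i < length q \<longrightarrow> primal_adj E (q ! i) (q ! Suc i)" for q
    using that
  proof (induction q rule: induct_list012)
    case (3 a b q)
    have "primal_adj E a b"
      using 3(4)[rule_format, of 0] by simp
    moreover have "f (last (b # q)) - f b \<le> sum_list (map x q)"
      using 3(2) 3(4) by fastforce
    ultimately show ?case
      using step[of a b] by simp
  qed auto
  from this[of p] have "f v - f u \<le> sum_list (map x (tl p))"
    using p by (auto simp: primal_path_def)
  also have "\<dots> \<le> sum_list (map x p)"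
    using p \<open>0 \<le> x u\<close> by (cases p) (auto simp: primal_path_def)
  also have "\<dots> = (\<Sum>w\<in>set p. x w)"
    using p by (simp add: primal_path_def sum_list_distinct_conv_sum_set)
  finally show ?thesis .
qed

lemma finite_primal_paths:
  assumes "finite V"
  shows "finite {p. primal_path V E u v p}"
  by (rule finite_subset[OF _ finite_subset_distinct[OF assms]]) (auto simp: primal_path_def)

lemma frac_dist_ge_1I:
  assumes "finite V" "\<And>p. primal_path V E u v p \<Longrightarrow> 1 \<le> (\<Sum>w\<in>set p. x w)"
  shows "1 \<le> frac_dist V E x u v"
proof -
  have "finite {(\<Sum>w\<in>set p. x w) | p. primal_path V E u v p}"
    using finite_primal_paths[OF assms(1)] by (simp add: setcompr_eq_image)
  then show ?thesis
    unfolding frac_dist_def using assms(2) by auto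
qed

lemma hypergraph_finite_edges: "hypergraph V E \<Longrightarrow> finite E"
  by (auto simp: hypergraph_def intro!: finite_subset[of E "Pow V"])

lemma rho_star_le:
  assumes "frac_edge_cover V E x y"
  shows "rho_star V E x \<le> (\<Sum>e\<in>E. y e)"
  unfolding rho_star_def using assms
  by (intro cInf_lower bdd_belowI[of _ 0]) (auto simp: frac_edge_cover_def intro!: sum_nonneg)

text \<open>Weak duality: the indicator of \<open>P\<close>, divided by \<open>k\<close>, is a fractional independent set.\<close>

lemma rho_star_set_ge:
  assumes H: "hypergraph V E" and P: "P \<subseteq> S" "P \<subseteq> V"
    and k: "0 < k" "\<And>e. e \<in> E \<Longrightarrow> card (e \<inter> P) \<le> k"
  shows "card P / k \<le> rho_star_set V E S"
  unfolding rho_star_def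
proof (rule cInf_greatest)
  have fin: "finite E" "finite V" "finite P"
    using H P hypergraph_finite_edges[OF H] by (auto simp: hypergraph_def intro: finite_subset)
  have "frac_edge_cover V E (indicator S) (\<lambda>_. 1)"
  proof -
    have "1 \<le> card {e \<in> E. v \<in> e}" if "v \<in> V" for v
      using H that fin by (auto simp: hypergraph_def Suc_le_eq card_gt_0_iff)
    then show ?thesis
      by (fastforce simp: frac_edge_cover_def indicator_def)
  qed
  then show "{(\<Sum>e\<in>E. y e) | y. frac_edge_cover V E (indicator S) y} \<noteq> {}"
    by blast
  fix r assume "r \<in> {(\<Sum>e\<in>E. y e) | y. frac_edge_cover V E (indicator S) y}"
  then obtain y where y: "frac_edge_cover V E (indicator S) y" "r = (\<Sum>e\<in>E. y e)"
    by auto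
  have "real (card P) = (\<Sum>v\<in>P. 1)"
    by simp
  also have "\<dots> \<le> (\<Sum>v\<in>P. \<Sum>e\<in>{e \<in> E. v \<in> e}. y e)"
    using y P by (intro sum_mono) (force simp: frac_edge_cover_def)
  also have "\<dots> = (\<Sum>e\<in>E. \<Sum>v\<in>{v \<in> P. v \<in> e}. y e)"
    by (rule sum.swap_restrict[OF fin(3,1)])
  also have "\<dots> = (\<Sum>e\<in>E. card (e \<inter> P) * y e)"
    by (simp add: Int_def conj_commute)
  also have "\<dots> \<le> (\<Sum>e\<in>E. k * y e)"
    using y k by (intro sum_mono mult_right_mono) (auto simp: frac_edge_cover_def)
  also have "\<dots> = k * r"
    by (simp add: y sum_distrib_left)
  finally show "card P / k \<le> r"
    using k by (simp add: field_simps)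
qed

section \<open>The interval hypergraph\<close>

text \<open>
  Intervals are numbered as in a heap: \<open>m\<close> has halves \<open>2 * m\<close> and \<open>2 * m + 1\<close>, and the leaves are
  \<open>2 ^ n, \<dots>, 2 ^ (n + 1) - 1\<close>. The vertex \<open>c \<ge> 2\<close> is the copy of the interval \<open>c div 2\<close> that
  belongs to its half \<open>c\<close>; the vertices \<open>0\<close> and \<open>1\<close> are the two endpoints. Positions are measured
  in leaf lengths and shifted by \<open>2 ^ n\<close>, so that leaf \<open>t\<close> occupies \<open>[t, t + 1]\<close>.
\<close>

definition len :: "nat \<Rightarrow> nat \<Rightarrow> nat" where
  "len n c = (if c < 2 then 0 else 2 ^ (n - floor_log (c div 2)))"

text \<open>The leftmost leaf below an interval is its heap number times its length; this already
  includes the shift by \<open>2 ^ n\<close>.\<close>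

definition lo :: "nat \<Rightarrow> nat \<Rightarrow> nat" where
  "lo n c = (if c = 0 then 2 ^ n else if c = 1 then 2 ^ (n + 1) else (c div 2) * len n c)"

definition touch :: "nat \<Rightarrow> nat \<Rightarrow> nat \<Rightarrow> bool" where
  "touch n u v \<longleftrightarrow> lo n u \<le> lo n v + len n v \<and> lo n v \<le> lo n u + len n u"

definition leaves :: "nat \<Rightarrow> nat set" where
  "leaves n = {2 ^ n..<2 ^ (n + 1)}"

text \<open>As a vertex, \<open>t div 2 ^ k\<close> is the copy of its parent interval for the half
  containing \<open>t\<close>. The range stops before \<open>k = n\<close>, where a leaf would yield
  the endpoint \<open>1\<close>.\<close>

definition leaf_edge :: "nat \<Rightarrow> nat \<Rightarrow> nat set" where
  "leaf_edge n t = (\<lambda>k. t div 2 ^ k) ` {..<n}"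

definition verts :: "nat \<Rightarrow> nat set" where
  "verts n = {..<2 ^ (n + 1)}"

definition edges :: "nat \<Rightarrow> nat set set" where
  "edges n = leaf_edge n ` leaves n \<union> {{u, v} | u v. u \<in> verts n \<and> v \<in> verts n \<and> touch n u v}"

definition sibling :: "nat \<Rightarrow> nat" where
  "sibling c = (if even c then c + 1 else c - 1)"

section \<open>Heap arithmetic: siblings, ancestors and levels\<close>

lemma endpoints_in_verts: "0 \<in> verts n" "1 \<in> verts n"
  using one_less_power[of "2 :: nat" "n + 1"] by (simp_all add: verts_def)

lemma sibling_div2 [simp]: "sibling c div 2 = c div 2"
  by (auto simp: sibling_def elim!: evenE oddE)

lemma sibling_neq: "sibling c \<noteq> c"
  by (auto simp: sibling_def elim!: evenE oddE)

lemma inj_sibling: "inj sibling"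
  by (rule inj_on_inverseI[where g = sibling]) (auto simp: sibling_def)

lemma div_power2_half: "(t :: nat) div 2 ^ k div 2 = t div 2 ^ Suc k"
  by (metis div_mult2_eq power_Suc2)

lemma floor_log_leaf:
  assumes "t \<in> leaves n" "k \<le> n"
  shows "floor_log (t div 2 ^ k) = n - k"
proof (rule floor_log_eqI)
  have n: "2 ^ n = 2 ^ (n - k) * (2 ^ k :: nat)"
    using assms by (simp flip: power_add)
  show "2 ^ (n - k) \<le> t div 2 ^ k"
    using assms n by (simp add: leaves_def less_eq_div_iff_mult_less_eq)
  then show "t div 2 ^ k > 0"
    by (meson dual_order.strict_trans1 zero_less_numeral zero_less_power)
  show "t div 2 ^ k < 2 * 2 ^ (n - k)"
    using assms n by (simp add: leaves_def div_less_iff_less_mult)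
qed

lemma leaf_ancestor_eqD:
  assumes "s \<in> leaves n" "t \<in> leaves n" "k \<le> n" "l \<le> n" "s div 2 ^ k = t div 2 ^ l"
  shows "k = l"
  using assms floor_log_leaf[of s n k] floor_log_leaf[of t n l] by simp

lemma inj_on_ancestor:
  assumes "t \<in> leaves n"
  shows "inj_on (\<lambda>k. t div 2 ^ k) {..<n}"
  using leaf_ancestor_eqD[OF assms assms] by (auto simp: inj_on_def)

lemma card_leaves: "card (leaves n) = 2 ^ n"
  by (simp add: leaves_def)

text \<open>The premise on \<open>c\<close> admits both copies of the interval: leaf edges need one
  of them, separators both.\<close>

lemma above_leaf:
  assumes t: "t \<in> leaves n" and "k < n" and c: "c div 2 = t div 2 ^ Suc k"
  shows "c \<in> verts n" "2 \<le> c" "lo n c \<le> t" "t < lo n c + len n c"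
proof -
  have "t div 2 ^ n \<le> t div 2 ^ Suc k"
    using \<open>k < n\<close> by (intro div_le_mono2 power_increasing) auto
  moreover have "0 < t div 2 ^ n"
    using t by (simp add: leaves_def div_greater_zero_iff)
  ultimately have "0 < c div 2"
    using c by linarith
  then show c2: "2 \<le> c"
    by auto
  have "len n c = 2 ^ (n - floor_log (t div 2 ^ Suc k))"
    using c2 c by (simp add: len_def)
  then have len: "len n c = 2 ^ Suc k"
    using floor_log_leaf[OF t, of "Suc k"] \<open>k < n\<close> by simp
  then have lo: "lo n c = t div 2 ^ Suc k * 2 ^ Suc k"
    using c2 c by (simp add: lo_def)
  show "lo n c \<le> t" "t < lo n c + len n c"
    unfolding len lo using dividend_less_div_times[of "2 ^ Suc k" t] by simp_all
  have "c div 2 \<le> t div 2"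
    unfolding c by (intro div_le_mono2) (auto intro: self_le_power)
  also have "\<dots> < 2 ^ n"
    using t by (simp add: leaves_def less_mult_imp_div_less)
  finally show "c \<in> verts n"
    by (auto simp: verts_def)
qed

lemma touch_common_point:
  assumes "lo n u \<le> t" "t \<le> lo n u + len n u" "lo n v \<le> t" "t \<le> lo n v + len n v"
  shows "touch n u v"
  using assms by (auto simp: touch_def)

lemma leaf_edgeE:
  assumes "c \<in> leaf_edge n t"
  obtains k where "k < n" "c = t div 2 ^ k" "c div 2 = t div 2 ^ Suc k"
proof -
  obtain k where "k < n" "c = t div 2 ^ k"
    using assms by (auto simp: leaf_edge_def)
  then show ?thesis
    using that[of k] div_power2_half by blast
qed

text \<open>\<open>t\<close> is the largest element of its edge. Injectivity lets the cover count
  edges by their leaves.\<close>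

lemma inj_leaf_edge:
  assumes "0 < n"
  shows "inj (leaf_edge n)"
proof (rule injI)
  have le: "s \<le> t" if "leaf_edge n s = leaf_edge n t" for s t
  proof -
    have "s \<in> leaf_edge n s"
      using assms by (auto simp: leaf_edge_def intro!: image_eqI[of _ _ 0])
    then show ?thesis
      using that by (auto simp: leaf_edge_def)
  qed
  show "s = t" if "leaf_edge n s = leaf_edge n t" for s t
    using le[OF that] le[OF that[symmetric]] by simp
qed

lemma hypergraph_edges:
  assumes "0 < n"
  shows "hypergraph (verts n) (edges n)"
proof -
  have "leaf_edge n t \<subseteq> verts n" if "t \<in> leaves n" for t
    using above_leaf(1)[OF that] by (auto elim!: leaf_edgeE)
  moreover have "leaf_edge n t \<noteq> {}" for t
    using assms by (auto simp: leaf_edge_def)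
  \<comment> \<open>Every interval touches itself, so all singletons are edges.\<close>
  moreover have "\<exists>e\<in>edges n. v \<in> e" if "v \<in> verts n" for v
    using that by (intro bexI[of _ "{v, v}"]) (auto simp: edges_def touch_def)
  moreover have "e \<subseteq> verts n" if "e \<in> edges n" for e
    using that calculation(1) by (auto simp: edges_def)
  moreover have "e \<noteq> {}" if "e \<in> edges n" for e
    using that calculation(2) by (auto simp: edges_def)
  moreover have "finite (verts n)"
    by (simp add: verts_def)
  ultimately show ?thesis
    unfolding hypergraph_def by blast
qed

text \<open>All intervals in a leaf edge contain that leaf, so leaf edges add no adjacency beyond
  touching.\<close>

lemma edges_touch:
  assumes "e \<in> edges n" "u \<in> e" "v \<in> e"
  shows "touch n u v"
  using assms unfolding edges_def
proof (elim UnE imageE)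
  fix t assume t: "e = leaf_edge n t" "t \<in> leaves n"
  then have "lo n c \<le> t \<and> t \<le> lo n c + len n c" if "c \<in> e" for c
    using that above_leaf(3,4)[OF t(2)] by (auto elim!: leaf_edgeE intro: less_imp_le)
  then show ?thesis
    using assms touch_common_point by blast
qed (auto simp: touch_def)

section \<open>The fractional separator and its cover\<close>

definition weight :: "nat \<Rightarrow> nat \<Rightarrow> real" where
  "weight n c = len n c / 2 ^ n"

lemma frac_separator_weight: "frac_separator (verts n) (edges n) {0} {1} (weight n)"
proof -
  have "1 \<le> (\<Sum>w\<in>set p. weight n w)" if p: "primal_path (verts n) (edges n) 0 1 p" for p
  proof -
    \<comment> \<open>The potential is the right end of the interval. A touching \<open>w'\<close>
      starts no later than \<open>w\<close> ends, so entering it moves the right end by at most its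
      length.\<close>
    define f where "f c = (lo n c + len n c) / 2 ^ n" for c
    have "f w' - f w \<le> weight n w'" if "primal_adj (edges n) w w'" for w w'
    proof -
      have "touch n w w'"
        using that edges_touch by (auto simp: primal_adj_def)
      then have "real (lo n w' + len n w') - real (lo n w + len n w) \<le> len n w'"
        by (simp add: touch_def)
      then show ?thesis
        by (simp add: f_def weight_def divide_right_mono flip: diff_divide_distrib)
    qed
    then have "f 1 - f 0 \<le> (\<Sum>w\<in>set p. weight n w)"
      by (rule primal_path_potential[OF p]) (auto simp: weight_def)
    moreover have "f 1 - f 0 = 1"
      by (simp add: f_def lo_def len_def)
    ultimately show ?thesis
      by simp
  qed
  then have "1 \<le> frac_dist (verts n) (edges n) (weight n) 0 1"
    by (intro frac_dist_ge_1I) (auto simp: verts_def)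
  moreover have "len n c \<le> 2 ^ n" for c
    by (simp add: len_def)
  then have "real (len n c) \<le> 2 ^ n" for c
    using of_nat_mono[of "len n c" "2 ^ n"] by simp
  then have "weight n c \<le> 1" for c
    by (simp add: weight_def)
  ultimately show ?thesis
    by (simp add: frac_separator_def weight_def)
qed

text \<open>The edge of every leaf below the half \<open>c\<close> contains \<open>c\<close>, and
  these are half of the leaves below \<open>c div 2\<close>.\<close>

lemma card_leaf_edges_ge:
  assumes c: "c \<in> verts n" "2 \<le> c"
  shows "len n c \<le> 2 * card {t \<in> leaves n. c \<in> leaf_edge n t}"
proof -
  define i where "i = floor_log (c div 2)"
  have i: "2 ^ i \<le> c div 2" "c div 2 < 2 ^ Suc i"
    using c floor_log_exp2_le[of "c div 2"] floor_log_exp2_gt[of "c div 2"] by (auto simp: i_def)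
  have "c div 2 < 2 ^ n"
    using c by (auto simp: verts_def)
  then have "(2::nat) ^ i < 2 ^ n"
    using i by linarith
  then have "i < n"
    by simp
  then obtain k where k: "n = Suc i + k"
    using less_imp_Suc_add by force
  have cb: "2 ^ Suc i \<le> c" "Suc c \<le> 2 ^ Suc (Suc i)"
    using i by auto
  have "{c * 2 ^ k..<c * 2 ^ k + 2 ^ k} \<subseteq> {t \<in> leaves n. c \<in> leaf_edge n t}"
  proof
    fix t assume t: "t \<in> {c * 2 ^ k..<c * 2 ^ k + 2 ^ k}"
    then have "t div 2 ^ k = c"
      by (intro div_nat_eqI) (auto simp: algebra_simps)
    then have "c \<in> leaf_edge n t"
      using k by (auto simp: leaf_edge_def intro!: image_eqI[of _ _ k])
    moreover have "2 ^ n \<le> c * 2 ^ k" "Suc c * 2 ^ k \<le> 2 ^ Suc n"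
      using mult_right_mono[OF cb(1), of "2 ^ k"] mult_right_mono[OF cb(2), of "2 ^ k"]
      by (simp_all add: k power_add)
    then have "t \<in> leaves n"
      using t by (simp add: leaves_def)
    ultimately show "t \<in> {t \<in> leaves n. c \<in> leaf_edge n t}"
      by simp
  qed
  then have "card {c * 2 ^ k..<c * 2 ^ k + 2 ^ k} \<le> card {t \<in> leaves n. c \<in> leaf_edge n t}"
    by (rule card_mono[rotated]) (simp add: leaves_def)
  moreover have "len n c = 2 * 2 ^ k"
  proof -
    have "len n c = 2 ^ (n - i)"
      using c by (simp add: len_def i_def)
    also have "n - i = Suc k"
      by (simp add: k)
    finally show ?thesis
      by simp
  qed
  ultimately show ?thesis
    by simp
qed

lemma rho_star_weight:
  assumes "0 < n"
  shows "rho_star (verts n) (edges n) (weight n) \<le> 2"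
proof -
  define y :: "nat set \<Rightarrow> real"
    where "y e = (if e \<in> leaf_edge n ` leaves n then 2 / 2 ^ n else 0)" for e
  have inj: "inj_on (leaf_edge n) A" for A
    using inj_leaf_edge[OF assms] inj_on_subset by blast
  have fin: "finite (edges n)"
    using hypergraph_edges[OF assms] hypergraph_finite_edges by blast
  have "(2::real) ^ 1 \<le> 2 ^ n"
    using assms by (intro power_increasing) auto
  then have "0 \<le> y e \<and> y e \<le> 1" for e
    by (simp add: y_def)
  moreover have "weight n v \<le> (\<Sum>e\<in>{e \<in> edges n. v \<in> e}. y e)" if "v \<in> verts n" for v
  proof (cases "2 \<le> v")
    case True
    let ?T = "{t \<in> leaves n. v \<in> leaf_edge n t}"
    have "weight n v \<le> (2 * card ?T) / 2 ^ n"
      unfolding weight_def using card_leaf_edges_ge[OF that True]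
      by (intro divide_right_mono of_nat_mono) auto
    also have "\<dots> = (\<Sum>e\<in>leaf_edge n ` ?T. y e)"
      by (simp add: sum.reindex inj y_def)
    also have "\<dots> \<le> (\<Sum>e\<in>{e \<in> edges n. v \<in> e}. y e)"
      using fin by (intro sum_mono2) (auto simp: edges_def y_def)
    finally show ?thesis .
  qed (auto simp: weight_def len_def y_def intro!: sum_nonneg)
  ultimately have "frac_edge_cover (verts n) (edges n) (weight n) y"
    by (auto simp: frac_edge_cover_def)
  then have "rho_star (verts n) (edges n) (weight n) \<le> (\<Sum>e\<in>edges n. y e)"
    by (rule rho_star_le)
  also have "\<dots> = (\<Sum>e\<in>leaf_edge n ` leaves n. y e)"
    using fin by (intro sum.mono_neutral_right) (auto simp: edges_def y_def)
  also have "\<dots> = 2"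
    by (simp add: y_def card_image inj card_leaves)
  finally show ?thesis .
qed

section \<open>Integral separators\<close>

text \<open>Otherwise every leaf lies in an interval with a copy outside \<open>S\<close>; taken
  from left to right, these copies form a walk from \<open>0\<close> to \<open>1\<close>.\<close>

lemma separator_contains_branch:
  assumes S: "separator (verts n) (edges n) {0} {1} S" "0 \<notin> S" "1 \<notin> S"
  shows "\<exists>t\<in>leaves n. \<forall>k<n. \<forall>c. c div 2 = t div 2 ^ Suc k \<longrightarrow> c \<in> S"
proof (rule ccontr)
  assume "\<not> ?thesis"
  then have "\<forall>t\<in>leaves n. \<exists>c. c \<in> verts n - S \<and> lo n c \<le> t \<and> t < lo n c + len n c"
    using above_leaf by (metis DiffI)
  then obtain h where h: "\<And>t. t \<in> leaves n \<Longrightarrow> h t \<in> verts n - S"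
    "\<And>t. t \<in> leaves n \<Longrightarrow> lo n (h t) \<le> t \<and> t < lo n (h t) + len n (h t)"
    by metis
  \<comment> \<open>Entries \<open>1\<close> to \<open>2 ^ n\<close> run through the leaves, entry
    \<open>i\<close> belonging to leaf \<open>2 ^ n + i - 1\<close>; the endpoints come before and
    after.\<close>
  define g where "g i = (if i = 0 then 0 else if i = Suc (2 ^ n) then 1 else h (2 ^ n + i - 1))"
    for i :: nat
  have leaf: "2 ^ n + i - 1 \<in> leaves n" if "0 < i" "i \<le> 2 ^ n" for i
    using that by (auto simp: leaves_def)
  have 01: "0 \<in> verts n - S" "1 \<in> verts n - S"
    using S endpoints_in_verts by auto
  have gV: "g i \<in> verts n - S" if "i \<le> Suc (2 ^ n)" for i
    using that h(1)[OF leaf[of i]] 01 by (auto simp: g_def)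
  have gl: "lo n (g i) \<le> 2 ^ n + i - 1 \<and> 2 ^ n + i \<le> lo n (g i) + len n (g i)"
    if "0 < i" "i \<le> 2 ^ n" for i
    using h(2)[OF leaf[OF that]] that by (auto simp: g_def)
  have g0: "lo n (g 0) = 2 ^ n" "len n (g 0) = 0"
    and g1: "lo n (g (Suc (2 ^ n))) = 2 ^ n + 2 ^ n" "len n (g (Suc (2 ^ n))) = 0"
    by (auto simp: g_def lo_def len_def)
  have tg: "touch n (g i) (g (Suc i))" if "i < Suc (2 ^ n)" for i
  \<comment> \<open>The common point is where leaf \<open>i\<close> of the walk ends and the next
    one begins.\<close>
  proof (rule touch_common_point[where t = "2 ^ n + i"])
    show "lo n (g i) \<le> 2 ^ n + i" "2 ^ n + i \<le> lo n (g i) + len n (g i)"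
      using gl[of i] g0 that by (cases "i = 0"; simp)+
    show "lo n (g (Suc i)) \<le> 2 ^ n + i" "2 ^ n + i \<le> lo n (g (Suc i)) + len n (g (Suc i))"
      using gl[of "Suc i"] g1 that by (cases "i = 2 ^ n"; simp)+
  qed
  have "\<exists>e\<in>edges n. g i \<in> e \<and> g (Suc i) \<in> e" if i: "i < Suc (2 ^ n)" for i
  proof (rule bexI)
    have "g i \<in> verts n" "g (Suc i) \<in> verts n"
      using i gV[of i] gV[of "Suc i"] by simp_all
    then show "{g i, g (Suc i)} \<in> edges n"
      using tg[OF i] unfolding edges_def by blast
  qed simp
  moreover have "g (Suc i) \<in> verts n - S" if "i < Suc (2 ^ n)" for i
    using that by (intro gV) simp
  ultimately have "\<exists>p. primal_path (verts n) (edges n) (g 0) (g (Suc (2 ^ n))) p \<and> set p \<inter> S = {}"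
    using gV[of 0] by (intro primal_path_of_walk) blast+
  moreover have "g 0 = 0" "g (Suc (2 ^ n)) = 1"
    by (simp_all add: g_def)
  ultimately show False
    using S unfolding separator_def by auto
qed

lemma leaf_edge_meets_siblings:
  assumes s: "s \<in> leaves n" and t: "t \<in> leaves n"
  shows "card (leaf_edge n s \<inter> sibling ` leaf_edge n t) \<le> 1"
proof -
  \<comment> \<open>Siblings have the same parent, whose level fixes the height: \<open>s\<close>
    and \<open>t\<close> reach a common element in equally many steps.\<close>
  have level: "s div 2 ^ k = c"
    if c: "c \<in> leaf_edge n s" "c = sibling (t div 2 ^ k)" "k < n" for c k
  proof -
    obtain l where l: "l < n" "c = s div 2 ^ l" "c div 2 = s div 2 ^ Suc l"
      using c(1) by (rule leaf_edgeE)
    have "c div 2 = t div 2 ^ Suc k"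
      by (simp only: c(2) sibling_div2 div_power2_half)
    then have "s div 2 ^ Suc l = t div 2 ^ Suc k"
      using l(3) by (simp only:)
    then have "Suc l = Suc k"
      using l(1) c(3) leaf_ancestor_eqD[OF s t, of "Suc l" "Suc k"] by linarith
    then show ?thesis
      using l(2) by simp
  qed
  \<comment> \<open>Once the branches are at opposite halves of one interval, they agree everywhere
    above, so they part only once.\<close>
  have less: "\<not> k < l"
    if "s div 2 ^ k = sibling (t div 2 ^ k)" "s div 2 ^ l = sibling (t div 2 ^ l)" for k l
  proof
    assume "k < l"
    then obtain d where d: "l = Suc k + d"
      using less_imp_Suc_add by force
    have "s div 2 ^ Suc k = t div 2 ^ Suc k"
      using arg_cong[OF that(1), of "\<lambda>m. m div 2"] by (simp add: div_power2_half del: power_Suc)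
    then have "s div 2 ^ l = t div 2 ^ l"
      unfolding d power_add by (simp add: div_mult2_eq)
    then show False
      using that(2) sibling_neq by metis
  qed
  have "c = c'" if cc: "c \<in> leaf_edge n s \<inter> sibling ` leaf_edge n t"
    "c' \<in> leaf_edge n s \<inter> sibling ` leaf_edge n t" for c c'
  proof -
    obtain k l where k: "k < n" "c = sibling (t div 2 ^ k)"
      and l: "l < n" "c' = sibling (t div 2 ^ l)"
      using cc by (auto simp: leaf_edge_def)
    have eq: "s div 2 ^ k = c" "s div 2 ^ l = c'"
      using cc k l level by blast+
    then have "s div 2 ^ k = sibling (t div 2 ^ k)" "s div 2 ^ l = sibling (t div 2 ^ l)"
      using k(2) l(2) by (simp_all only:)
    then have "k = l"
      using less[of k l] less[of l k] by linarith
    then show ?thesis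
      using eq by (simp only:)
  qed
  moreover have "finite (leaf_edge n s \<inter> sibling ` leaf_edge n t)"
    by (simp add: leaf_edge_def)
  ultimately show ?thesis
    unfolding One_nat_def by (subst card_le_Suc0_iff_eq) blast+
qed

lemma rho_star_separator:
  assumes "0 < n" and S: "separator (verts n) (edges n) {0} {1} S" "0 \<notin> S" "1 \<notin> S"
  shows "n / 2 \<le> rho_star_set (verts n) (edges n) S"
proof -
  obtain t where t: "t \<in> leaves n"
    and tS: "\<And>k c. k < n \<Longrightarrow> c div 2 = t div 2 ^ Suc k \<Longrightarrow> c \<in> S"
    using separator_contains_branch[OF S] by blast
  define P where "P = sibling ` leaf_edge n t"
  have "card P = n"
    using inj_on_ancestor[OF t] inj_sibling
    by (simp add: P_def leaf_edge_def card_image inj_on_subset)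
  \<comment> \<open>\<open>S\<close> contains both copies above \<open>t\<close>, hence also the
    opposite ones.\<close>
  moreover have "P \<subseteq> S"
    using tS by (auto simp: P_def elim!: leaf_edgeE)
  moreover have "S \<subseteq> verts n"
    using S by (simp add: separator_def)
  moreover have "card (e \<inter> P) \<le> 2" if e: "e \<in> edges n" for e
    using e unfolding edges_def
  proof (elim UnE imageE)
    fix s assume "e = leaf_edge n s" "s \<in> leaves n"
    then show ?thesis
      using leaf_edge_meets_siblings[OF _ t] P_def by fastforce
  next
    assume "e \<in> {{u, v} | u v. u \<in> verts n \<and> v \<in> verts n \<and> touch n u v}"
    then obtain u v where "e = {u, v}"
      by blast
    then have "card (e \<inter> P) \<le> card {u, v}"
      by (intro card_mono) auto
    also have "\<dots> \<le> 2"
      by (simp add: card_insert_if)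
    finally show ?thesis .
  qed
  ultimately show ?thesis
    using rho_star_set_ge[OF hypergraph_edges[OF \<open>0 < n\<close>], of P S 2] by auto
qed

theorem theorem7p7:
  "\<exists>c\<^sub>1 c\<^sub>2 c\<^sub>3 :: real. c\<^sub>1 > 0 \<and> c\<^sub>2 > 0 \<and> c\<^sub>3 > 0 \<and>
     (\<forall>n::nat. n \<ge> 3 \<longrightarrow>
       (\<exists>(V :: nat set) (E :: nat set set) a b.
          hypergraph V E \<and> a \<in> V \<and> b \<in> V \<and> a \<noteq> b \<and>
          c\<^sub>1 * 2 ^ n \<le> real (card V) \<and> real (card V) \<le> c\<^sub>2 * 2 ^ n \<and>
          (\<exists>x. frac_separator V E {a} {b} x \<and> x a = 0 \<and> x b = 0 \<and> rho_star V E x \<le> 8) \<and>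
          (\<forall>S. separator V E {a} {b} S \<and> a \<notin> S \<and> b \<notin> S \<longrightarrow>
                 rho_star_set V E S \<ge> c\<^sub>3 * log 2 (real (card V)))))"
\<comment> \<open>There are exactly \<open>2 ^ (n + 1)\<close> vertices, so both size constants are
  2 and the logarithm is \<open>n + 1\<close>; \<open>(n + 1) / 3 \<le> n / 2\<close> holds from
  \<open>n = 2\<close> on.\<close>
proof (rule exI[of _ 2], rule exI[of _ 2], rule exI[of _ "1 / 3"], intro conjI allI impI)
  fix n :: nat assume n: "3 \<le> n"
  have card: "real (card (verts n)) = 2 ^ (n + 1)"
    by (simp add: verts_def)
  have log: "log 2 (real (card (verts n))) = n + 1"
    unfolding card by (simp only: log_pow_cancel)
  show "\<exists>(V :: nat set) E a b.
          hypergraph V E \<and> a \<in> V \<and> b \<in> V \<and> a \<noteq> b \<and>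
          2 * 2 ^ n \<le> real (card V) \<and> real (card V) \<le> 2 * 2 ^ n \<and>
          (\<exists>x. frac_separator V E {a} {b} x \<and> x a = 0 \<and> x b = 0 \<and> rho_star V E x \<le> 8) \<and>
          (\<forall>S. separator V E {a} {b} S \<and> a \<notin> S \<and> b \<notin> S \<longrightarrow>
                 rho_star_set V E S \<ge> 1 / 3 * log 2 (real (card V)))"
  proof (rule exI[of _ "verts n"], rule exI[of _ "edges n"], rule exI[of _ 0], rule exI[of _ 1],
      intro exI[of _ "weight n"] conjI allI impI)
    show "hypergraph (verts n) (edges n)"
      using n by (intro hypergraph_edges) simp
    show "rho_star (verts n) (edges n) (weight n) \<le> 8"
      using rho_star_weight[of n] n by simp
    fix S assume "separator (verts n) (edges n) {0} {1} S \<and> 0 \<notin> S \<and> 1 \<notin> S"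
    then have "n / 2 \<le> rho_star_set (verts n) (edges n) S"
      using rho_star_separator[of n S] n by simp
    moreover have "1 / 3 * (real n + 1) \<le> n / 2"
      using n by simp
    ultimately show "1 / 3 * log 2 (real (card (verts n))) \<le> rho_star_set (verts n) (edges n) S"
      unfolding log by simp
  qed (use card frac_separator_weight endpoints_in_verts in \<open>simp_all add: weight_def len_def\<close>)
qed simp_all

end
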